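(* Let $\eta\in\mathbb{R}$ and $q\ge0$ be fixed with $q\ne\frac12,\frac32,\frac52,\ldots$, and let $0<c<1$. Then, as $\beta\to\infty$, $$F_q^{(1)}(\eta,\beta)\sim\sum_{k=0}^\infty\frac{c_k}{\beta^k}\,\Phi_k^{(1)}(\eta),\qquad F_q^{(2)}(\eta,\beta)\sim\sum_{k=0}^\infty\frac{d_k}{\beta^k}\,\Phi_k^{(2)}(\eta,q),$$ where $$c_k=\frac{2^k(q+1)_k}{k!\,\left(q+\frac52\right)_k},\qquad d_k=\frac{2^k\left(-\frac12\right)_k}{k!\,\left(-q-\frac12\right)_k},$$ $$\Phi_k^{(1)}(\eta)=\frac{1}{2i}\int_{c-i\infty}^{c+i\infty}e^{\eta s}s^k\frac{ds}{\sin(\pi s)},\qquad \Phi_k^{(2)}(\eta,q)=\frac{1}{2i}\int_{c-i\infty}^{c+i\infty}e^{\eta s}s^{k-q-\frac32}\frac{ds}{\sin(\pi s)}.$$ (Here $\sim$ means that for every integer $N\ge0$ the remainder after the terms $k=0,\ldots,N-1$ is $\mathcal{O}(\beta^{-N})$.)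
   Context: The relativistic Fermi-Dirac integral is $F_q(\eta,\beta)=\int_0^\infty \frac{x^q\sqrt{1+\beta x/2}}{e^{x-\eta}+1}\,dx$ ($\beta\ge 0$, $q\ge0$, $\eta\in\mathbb{R}$). Let ${}_1F_1(a;b;z)=\sum_{k\ge0}\frac{(a)_k}{(b)_k}\frac{z^k}{k!}$, with $(a)_k$ the Pochhammer symbol. For $\beta>0$, $q\neq\frac12,\frac32,\ldots$ and $0<c<1$, with principal powers of $s$, define $$F_q^{(1)}(\eta,\beta)=\frac{1}{2\pi i}\int_{c-i\infty}^{c+i\infty}e^{\eta s}\,\frac{\pi s}{\sin(\pi s)}\,{}_1F_1\left(q+1;q+\tfrac52;\frac{2s}{\beta}\right)\frac{ds}{s},$$ $$F_q^{(2)}(\eta,\beta)=\frac{1}{2\pi i}\int_{c-i\infty}^{c+i\infty}e^{\eta s}\,\frac{\pi s}{\sin(\pi s)}\,{}_1F_1\left(-\tfrac12;-q-\tfrac12;\frac{2s}{\beta}\right)\frac{ds}{s^{q+\frac52}}.$$ The relativistic Fermi-Dirac integral is written in terms of these functions as $$F_q(\eta,\beta)=\left(\frac{2}{\beta}\right)^{q+1}\frac{\Gamma(-q-\frac32)\Gamma(q+1)}{\Gamma(-\frac12)}F_q^{(1)}(\eta,\beta)+\left(\frac{2}{\beta}\right)^{-\frac12}\Gamma\left(q+\tfrac32\right)F_q^{(2)}(\eta,\beta).$$ *)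

theory Defs
  imports "HOL-Analysis.Analysis" "HOL-Library.Landau_Symbols"
begin

text \<open>Integral over the upward vertical line \<open>Re s = c\<close>, parametrised by \<open>s = c + i t\<close>, so that
  \<open>ds = i dt\<close>. It is taken as a Lebesgue integral: for \<open>0 < c < 1\<close> the factor \<open>1 / sin (\<pi> s)\<close> decays
  exponentially and all other factors occurring below grow at most polynomially along the line,
  so all the integrals converge absolutely.\<close>

definition vline_integral :: "real \<Rightarrow> (complex \<Rightarrow> complex) \<Rightarrow> complex" where
  "vline_integral c f = (LINT t|lborel. f (Complex c t) * \<i>)"

definition hyp1F1 :: "complex \<Rightarrow> complex \<Rightarrow> complex \<Rightarrow> complex" where
  "hyp1F1 a b z = (\<Sum>k. pochhammer a k / pochhammer b k * (z ^ k / fact k))"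

definition FD1 :: "real \<Rightarrow> real \<Rightarrow> real \<Rightarrow> real \<Rightarrow> complex" where
  "FD1 c q \<eta> \<beta> = 1 / (2 * of_real pi * \<i>) * vline_integral c (\<lambda>s.
     exp (of_real \<eta> * s) * (of_real pi * s / sin (of_real pi * s)) *
     hyp1F1 (of_real (q + 1)) (of_real (q + 5/2)) (2 * s / of_real \<beta>) / s)"

definition FD2 :: "real \<Rightarrow> real \<Rightarrow> real \<Rightarrow> real \<Rightarrow> complex" where
  "FD2 c q \<eta> \<beta> = 1 / (2 * of_real pi * \<i>) * vline_integral c (\<lambda>s.
     exp (of_real \<eta> * s) * (of_real pi * s / sin (of_real pi * s)) *
     hyp1F1 (of_real (- 1/2)) (of_real (- q - 1/2)) (2 * s / of_real \<beta>) / s powr of_real (q + 5/2))"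

definition c_coeff :: "real \<Rightarrow> nat \<Rightarrow> real" where
  "c_coeff q k = 2 ^ k * pochhammer (q + 1) k / (fact k * pochhammer (q + 5/2) k)"

definition d_coeff :: "real \<Rightarrow> nat \<Rightarrow> real" where
  "d_coeff q k = 2 ^ k * pochhammer (- 1/2) k / (fact k * pochhammer (- q - 1/2) k)"

definition Phi1 :: "real \<Rightarrow> nat \<Rightarrow> real \<Rightarrow> complex" where
  "Phi1 c k \<eta> = 1 / (2 * \<i>) * vline_integral c (\<lambda>s.
     exp (of_real \<eta> * s) * s ^ k / sin (of_real pi * s))"

definition Phi2 :: "real \<Rightarrow> nat \<Rightarrow> real \<Rightarrow> real \<Rightarrow> complex" where
  "Phi2 c k \<eta> q = 1 / (2 * \<i>) * vline_integral c (\<lambda>s.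
     exp (of_real \<eta> * s) * s powr of_real (real k - q - 3/2) / sin (of_real pi * s))"

text \<open>\<open>f \<beta> \<sim> (\<Sum>k. a k / \<beta>^k)\<close> as \<open>\<beta> \<rightarrow> \<infinity>\<close>: for every \<open>N\<close> the remainder after \<open>N\<close> terms is
  \<open>O(\<beta>^-N)\<close>. The series need not converge.\<close>

definition has_asymp_series :: "(real \<Rightarrow> complex) \<Rightarrow> (nat \<Rightarrow> complex) \<Rightarrow> bool" where
  "has_asymp_series f a \<longleftrightarrow>
     (\<forall>N::nat. (\<lambda>\<beta>. f \<beta> - (\<Sum>k<N. a k / of_real \<beta> ^ k)) \<in> O[at_top](\<lambda>\<beta>. 1 / of_real \<beta> ^ N))"

end

theory Submission
  imports Defs
begin

text \<open>Since \<open>1 / \<bar>sin (\<pi> s)\<bar>\<close> decays like \<open>exp (- \<pi> \<bar>Im s\<bar>)\<close> on the line, a crude bound on the Taylor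
  remainder of \<open>1F1\<close> is enough: the ratio of consecutive Pochhammer quotients tends to \<open>1\<close>, so these
  quotients are \<open>O(2^k)\<close> and the remainder after \<open>N\<close> terms at \<open>z\<close> is
  \<open>O((2 \<bar>z\<bar>)^N exp (2 \<bar>z\<bar>))\<close>. At \<open>z = 2 s / \<beta>\<close> with \<open>\<beta> \<ge> 4\<close> this is
  \<open>O(\<beta>^-N exp (2 \<bar>s\<bar>))\<close>, which stays integrable against \<open>1 / sin (\<pi> s)\<close> because \<open>\<pi> > 3\<close>.\<close>

section \<open>Taylor remainder of the confluent hypergeometric series\<close>

lemma pochhammer_quotient_bound:
  fixes a b :: complex
  obtains M where "M \<ge> 0" "\<And>k. norm (pochhammer a k / pochhammer b k) \<le> M * 2 ^ k"
proof -
  define u where "u k = norm (pochhammer a k / pochhammer b k)" for k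
  \<comment> \<open>For \<open>k \<ge> K\<close> this threshold is exactly what gives
    \<open>norm a + k \<le> 2 * (k - norm b)\<close>, a ratio of consecutive quotients of at most
    2.\<close>
  obtain K :: nat where K: "real K \<ge> norm a + 2 * norm b"
    using real_arch_simple by blast
  have step: "u (Suc k) \<le> 2 * u k" if "k \<ge> K" for k
  proof -
    have "norm (a + of_nat k) \<le> norm a + real k"
      using norm_triangle_ineq[of a "of_nat k"] by simp
    also have "\<dots> \<le> 2 * (real k - norm b)"
      using K that by (smt (verit) of_nat_mono)
    also have "\<dots> \<le> 2 * norm (b + of_nat k)"
      using norm_diff_ineq[of "of_nat k" b] by (simp add: add.commute)
    \<comment> \<open>If the denominator vanishes, the quotient is 0 by the convention for division
      and the bound still holds.\<close>
    finally have "norm (a + of_nat k) / norm (b + of_nat k) \<le> 2"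
      by (cases "b + of_nat k = 0") (auto simp: divide_simps)
    then have "u k * (norm (a + of_nat k) / norm (b + of_nat k)) \<le> u k * 2"
      by (intro mult_left_mono) (auto simp: u_def)
    then show ?thesis
      by (simp add: u_def pochhammer_Suc norm_mult norm_divide mult_ac)
  qed
  \<comment> \<open>A sum of nonnegative terms dominates each of them, so \<open>M\<close> covers
    the indices up to \<open>K\<close>; beyond \<open>K\<close>, doubling at each step propagates
    the bound.\<close>
  define M where "M = (\<Sum>k\<le>K. u k)"
  have u_nonneg: "u k \<ge> 0" for k
    by (simp add: u_def)
  have M0: "M \<ge> 0"
    unfolding M_def by (intro sum_nonneg u_nonneg)
  have small: "u k \<le> M * 2 ^ k" if "k \<le> K" for k
  proof -
    have "u k \<le> M"
      unfolding M_def using that u_nonneg by (intro member_le_sum) auto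
    also have "\<dots> \<le> M * 2 ^ k"
      using M0 mult_left_mono[of 1 "2 ^ k" M] by simp
    finally show ?thesis .
  qed
  have "u k \<le> M * 2 ^ k" for k
  proof (cases "k \<le> K")
    case False
    then have "K \<le> k" by simp
    then show ?thesis
    proof (induction k rule: dec_induct)
      case base
      show ?case by (rule small) simp
    next
      case (step n)
      then show ?case using \<open>\<And>k. K \<le> k \<Longrightarrow> u (Suc k) \<le> 2 * u k\<close>[of n] by simp
    qed
  qed (rule small)
  with M0 show ?thesis
    by (intro that[of M]) (auto simp: u_def)
qed

text \<open>The series is dominated by \<open>M\<close> times the exponential series at
  \<open>2 * norm z\<close>. In its tail, \<open>fact (k + N) \<ge> fact k\<close> lets the factor
  \<open>(2 * norm z) ^ N\<close> be pulled out, leaving a full exponential series. One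
  \<open>M\<close> serves all \<open>N\<close> and \<open>z\<close>, which matters because
  \<open>z\<close> later runs over a whole line and scales with \<beta>.\<close>

lemma hyp1F1_remainder_bound:
  obtains M where "M \<ge> 0"
    "\<And>N z. norm (hyp1F1 a b z - (\<Sum>k<N. pochhammer a k / pochhammer b k * (z ^ k / fact k)))
             \<le> M * (2 * norm z) ^ N * exp (2 * norm z)"
proof -
  obtain M where M: "M \<ge> 0" "\<And>k. norm (pochhammer a k / pochhammer b k) \<le> M * 2 ^ k"
    using pochhammer_quotient_bound[of a b] by blast
  have "norm (hyp1F1 a b z - (\<Sum>k<N. pochhammer a k / pochhammer b k * (z ^ k / fact k)))
      \<le> M * (2 * norm z) ^ N * exp (2 * norm z)" for N z
  proof -
    define f where "f k = pochhammer a k / pochhammer b k * (z ^ k / fact k)" for k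
    define e where "e k = (2 * norm z) ^ k / fact k" for k
    have e_sums: "e sums exp (2 * norm z)"
      unfolding e_def using exp_converges[of "2 * norm z"] by (simp add: divide_inverse_commute)
    have f_le: "norm (f k) \<le> M * e k" for k
      using mult_right_mono[OF M(2)[of k], of "norm (z ^ k / fact k)"]
      by (simp add: f_def e_def norm_mult norm_divide norm_power power_mult_distrib mult_ac)
    have f_sum: "summable f"
      by (rule summable_comparison_test'[of "\<lambda>k. M * e k" 0])
         (use e_sums f_le in \<open>auto simp: sums_iff intro: summable_mult\<close>)
    have e_shift: "e (k + N) \<le> (2 * norm z) ^ N * e k" for k
    proof -
      have "(2 * norm z) ^ (k + N) / fact (k + N) \<le> (2 * norm z) ^ (k + N) / fact k"
        by (intro divide_left_mono fact_mono mult_pos_pos) auto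
      then show ?thesis by (simp add: e_def power_add mult_ac)
    qed
    have tail_le: "norm (f (k + N)) \<le> M * (2 * norm z) ^ N * e k" for k
      using f_le[of "k + N"] mult_left_mono[OF e_shift[of k] M(1)] by (simp add: mult_ac)
    have tail_sums: "(\<lambda>k. M * (2 * norm z) ^ N * e k) sums (M * (2 * norm z) ^ N * exp (2 * norm z))"
      using e_sums by (rule sums_mult)
    have "hyp1F1 a b z - (\<Sum>k<N. f k) = (\<Sum>k. f (k + N))"
      using suminf_minus_initial_segment[OF f_sum, of N] by (simp add: hyp1F1_def f_def)
    moreover have "norm (\<Sum>k. f (k + N)) \<le> (\<Sum>k. M * (2 * norm z) ^ N * e k)"
      using tail_le tail_sums by (intro norm_suminf_le) (auto simp: sums_iff)
    ultimately show ?thesis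
      using tail_sums by (simp add: sums_iff f_def)
  qed
  with M(1) show ?thesis by (rule that)
qed

section \<open>Integrability and measurability along the vertical line\<close>

text \<open>A single term of the exponential series is at most the whole sum, all terms being
  nonnegative.\<close>

lemma power_le_fact_exp:
  fixes x :: real
  assumes "x \<ge> 0"
  shows "x ^ n \<le> fact n * exp x"
proof -
  have sums: "(\<lambda>k. x ^ k / fact k) sums exp x"
    using exp_converges[of x] by (simp add: divide_inverse_commute)
  have "(\<Sum>k\<in>{n}. x ^ k / fact k) \<le> (\<Sum>k. x ^ k / fact k)"
    using sums assms by (intro sum_le_suminf) (auto simp: sums_iff)
  then show ?thesis
    using sums by (simp add: sums_iff field_simps)
qed

lemma integrable_exp_minus_abs: "integrable lborel (\<lambda>t::real. exp (- \<bar>t\<bar>))"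
proof -
  define h where "h t = indicator {0..} t * exp (- t)" for t :: real
  have "(\<lambda>t::real. exp (- t)) absolutely_integrable_on {0..}"
    using has_integral_exp_minus_to_infinity[of 1 0]
    by (intro nonnegative_absolutely_integrable_1) (auto simp: integrable_on_def)
  then have h: "integrable lborel h"
    unfolding set_integrable_def h_def [abs_def] by (simp add: integrable_completion)
  \<comment> \<open>Adding the reflection of \<open>h\<close> gives
    \<open>exp (- \<bar>t\<bar>)\<close> except at 0, where the value is 2; domination therefore
    suffices.\<close>
  then have "integrable lborel (\<lambda>t. h t + h (0 + (- 1) * t))"
    by (intro Bochner_Integration.integrable_add lborel_integrable_real_affine) auto
  then show ?thesis
    by (rule Bochner_Integration.integrable_bound) (auto simp: h_def indicator_def)
qed

lemma measurable_Complex_line [measurable]: "Complex c \<in> borel_measurable borel"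
  by (intro borel_measurable_continuous_onI) (auto simp: Complex_eq intro!: continuous_intros)

lemma hyp1F1_measurable [measurable]: "hyp1F1 a b \<in> borel_measurable borel"
  unfolding hyp1F1_def [abs_def] by measurable

lemma vline_integral_cong:
  "(\<And>t. f (Complex c t) = g (Complex c t)) \<Longrightarrow> vline_integral c f = vline_integral c g"
  by (simp add: vline_integral_def)

lemma vline_integral_mult: "vline_integral c (\<lambda>s. x * f s) = x * vline_integral c f"
  unfolding vline_integral_def mult.assoc by (rule integral_mult_right_zero)

section \<open>Termwise expansion under the integral\<close>

text \<open>Serves both expansions: \<open>g\<close> collects every factor of the integrand except
  the hypergeometric one. The remainder bound is integrated against \<open>g\<close>; the decay rate
  3 absorbs the growth \<open>exp (2 * norm s)\<close> and leaves
  \<open>exp (- \<bar>t\<bar>)\<close>.\<close>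

lemma vline_integral_hyp1F1_asymp:
  fixes g :: "complex \<Rightarrow> complex" and c C :: real
  assumes meas: "(\<lambda>t. g (Complex c t)) \<in> borel_measurable borel"
    and decay: "\<And>t. norm (g (Complex c t)) \<le> C * exp (- 3 * \<bar>t\<bar>)"
  shows "has_asymp_series (\<lambda>\<beta>. vline_integral c (\<lambda>s. g s * hyp1F1 a b (2 * s / of_real \<beta>)))
           (\<lambda>k. 2 ^ k * pochhammer a k / (fact k * pochhammer b k) * vline_integral c (\<lambda>s. g s * s ^ k))"
  unfolding has_asymp_series_def
proof
  fix N :: nat
  note [measurable] = meas
  obtain M where M: "M \<ge> 0"
    "\<And>N z. norm (hyp1F1 a b z - (\<Sum>k<N. pochhammer a k / pochhammer b k * (z ^ k / fact k)))
             \<le> M * (2 * norm z) ^ N * exp (2 * norm z)"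
    using hyp1F1_remainder_bound[of a b] by blast
  define A where "A k = 2 ^ k * pochhammer a k / (fact k * pochhammer b k)" for k
  \<comment> \<open>The order \<open>n\<close> is kept free: \<open>n = N\<close> yields the error
    estimate, \<open>n = 0\<close> the integrability of the full integrand.\<close>
  define R where "R n \<beta> s = hyp1F1 a b (2 * s / of_real \<beta>) - (\<Sum>k<n. A k * s ^ k / of_real \<beta> ^ k)"
    for n and \<beta> :: real and s
  have C0: "C \<ge> 0"
    using order_trans[OF norm_ge_zero decay[of 0]] by simp
  have pow_le: "norm s ^ n \<le> fact n * exp (norm s)" for n and s :: complex
    by (rule power_le_fact_exp) simp
  have line: "norm (Complex c t) \<le> \<bar>c\<bar> + \<bar>t\<bar>" for t
    using cmod_le[of "Complex c t"] by simp
  have weight: "norm (g (Complex c t)) * exp (2 * norm (Complex c t)) \<le> C * exp (2 * \<bar>c\<bar>) * exp (- \<bar>t\<bar>)" for t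
  proof -
    have "exp (2 * norm (Complex c t)) \<le> exp (2 * \<bar>c\<bar> + 2 * \<bar>t\<bar>)"
      using line[of t] by simp
    then have "norm (g (Complex c t)) * exp (2 * norm (Complex c t))
        \<le> C * exp (- 3 * \<bar>t\<bar>) * exp (2 * \<bar>c\<bar> + 2 * \<bar>t\<bar>)"
      using decay[of t] C0 by (intro mult_mono) auto
    then show ?thesis
      by (simp add: mult.assoc flip: exp_add)
  qed
  have R_le: "norm (g (Complex c t) * R n \<beta> (Complex c t))
      \<le> M * 4 ^ n * fact n * C * exp (2 * \<bar>c\<bar>) / \<beta> ^ n * exp (- \<bar>t\<bar>)" if "\<beta> \<ge> 4" for n \<beta> t
  proof -
    define s where "s = Complex c t"
    define z where "z = 2 * s / of_real \<beta>"
    have norm_z: "2 * norm z = 4 * norm s / \<beta>"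
      using that by (simp add: z_def norm_mult norm_divide)
    have "R n \<beta> s = hyp1F1 a b z - (\<Sum>k<n. pochhammer a k / pochhammer b k * (z ^ k / fact k))"
      by (simp add: R_def A_def z_def power_divide power_mult_distrib mult_ac)
    then have "norm (R n \<beta> s) \<le> M * (2 * norm z) ^ n * exp (2 * norm z)"
      using M(2) by simp
    \<comment> \<open>Since \<open>2 * norm z = 4 * norm s / \<beta>\<close>, the condition
      \<open>\<beta> \<ge> 4\<close> bounds the exponential by \<open>exp (norm s)\<close>. The
      power of \<open>norm s\<close> costs a second such factor, for a total of
      \<open>exp (2 * norm s)\<close>.\<close>
    also have "\<dots> \<le> M * (4 ^ n * (fact n * exp (norm s)) / \<beta> ^ n) * exp (norm s)"
    proof (intro mult_mono mult_left_mono M(1))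
      show "(2 * norm z) ^ n \<le> 4 ^ n * (fact n * exp (norm s)) / \<beta> ^ n"
        unfolding norm_z power_divide power_mult_distrib
        using that pow_le by (intro divide_right_mono mult_left_mono) auto
      show "exp (2 * norm z) \<le> exp (norm s)"
        using that mult_right_mono[of 4 \<beta> "norm s"] by (subst norm_z) (simp add: field_simps)
    qed (use that M(1) in auto)
    also have "\<dots> = M * 4 ^ n * fact n / \<beta> ^ n * exp (2 * norm s)"
      by (simp add: exp_double power2_eq_square)
    finally have "norm (g s * R n \<beta> s) \<le> norm (g s) * (M * 4 ^ n * fact n / \<beta> ^ n * exp (2 * norm s))"
      unfolding norm_mult by (intro mult_left_mono) auto
    also have "\<dots> = M * 4 ^ n * fact n / \<beta> ^ n * (norm (g s) * exp (2 * norm s))"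
      by simp
    also have "\<dots> \<le> M * 4 ^ n * fact n / \<beta> ^ n * (C * exp (2 * \<bar>c\<bar>) * exp (- \<bar>t\<bar>))"
      using weight[of t] M(1) that unfolding s_def by (intro mult_left_mono) auto
    finally show ?thesis
      by (simp add: s_def mult_ac)
  qed
  have int_R: "integrable lborel (\<lambda>t. g (Complex c t) * R n \<beta> (Complex c t) * \<i>)"
    if "\<beta> \<ge> 4" for n \<beta>
  proof (rule Bochner_Integration.integrable_bound[OF integrable_mult_right[OF integrable_exp_minus_abs,
            of "M * 4 ^ n * fact n * C * exp (2 * \<bar>c\<bar>) / \<beta> ^ n"]])
    show "AE t in lborel. norm (g (Complex c t) * R n \<beta> (Complex c t) * \<i>)
        \<le> norm (M * 4 ^ n * fact n * C * exp (2 * \<bar>c\<bar>) / \<beta> ^ n * exp (- \<bar>t\<bar>))"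
      using order_trans[OF R_le[OF that] abs_ge_self] by (simp add: norm_mult)
  qed (unfold R_def, measurable)
  have int_hyp: "integrable lborel (\<lambda>t. g (Complex c t) * hyp1F1 a b (2 * Complex c t / of_real \<beta>) * \<i>)"
    if "\<beta> \<ge> 4" for \<beta>
    using int_R[OF that, of 0] by (simp add: R_def)
  have int_pow: "integrable lborel (\<lambda>t. g (Complex c t) * Complex c t ^ k * \<i>)" for k
  proof (rule Bochner_Integration.integrable_bound[OF integrable_mult_right[OF integrable_exp_minus_abs,
            of "fact k * C * exp (2 * \<bar>c\<bar>)"]])
    have "norm (g (Complex c t)) * norm (Complex c t) ^ k \<le> fact k * C * exp (2 * \<bar>c\<bar>) * exp (- \<bar>t\<bar>)" for t
    proof -
      \<comment> \<open>The exponent is weakened to twice the norm so that \<open>weight\<close>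
        applies.\<close>
      have "norm (Complex c t) ^ k \<le> fact k * exp (2 * norm (Complex c t))"
        using pow_le[of "Complex c t" k] by (rule order_trans) auto
      then have "norm (g (Complex c t)) * norm (Complex c t) ^ k
          \<le> norm (g (Complex c t)) * (fact k * exp (2 * norm (Complex c t)))"
        by (intro mult_left_mono) auto
      also have "\<dots> \<le> fact k * (C * exp (2 * \<bar>c\<bar>) * exp (- \<bar>t\<bar>))"
        using mult_left_mono[OF weight[of t], of "fact k"] by (simp add: mult_ac)
      finally show ?thesis by (simp add: mult_ac)
    qed
    then show "AE t in lborel. norm (g (Complex c t) * Complex c t ^ k * \<i>)
        \<le> norm (fact k * C * exp (2 * \<bar>c\<bar>) * exp (- \<bar>t\<bar>))"
      using C0 by (auto simp: norm_mult norm_power)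
  qed measurable
  \<comment> \<open>The integrated bound of \<open>R_le\<close> without its factor
    \<open>1 / \<beta> ^ N\<close>, hence independent of \<beta>.\<close>
  define B where "B = M * 4 ^ N * fact N * C * exp (2 * \<bar>c\<bar>) * (LINT t|lborel. exp (- \<bar>t\<bar>))"
  have "norm (vline_integral c (\<lambda>s. g s * hyp1F1 a b (2 * s / of_real \<beta>))
      - (\<Sum>k<N. A k * vline_integral c (\<lambda>s. g s * s ^ k) / of_real \<beta> ^ k))
      \<le> B * norm (1 / of_real \<beta> ^ N :: real)" if \<beta>: "\<beta> \<ge> 4" for \<beta> :: real
  proof -
    have "vline_integral c (\<lambda>s. g s * hyp1F1 a b (2 * s / of_real \<beta>))
        - (\<Sum>k<N. A k * vline_integral c (\<lambda>s. g s * s ^ k) / of_real \<beta> ^ k)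
      = vline_integral c (\<lambda>s. g s * hyp1F1 a b (2 * s / of_real \<beta>))
        - (\<Sum>k<N. A k / of_real \<beta> ^ k * vline_integral c (\<lambda>s. g s * s ^ k))"
      by simp
    \<comment> \<open>The finite sum moves under the integral by linearity, each piece being
      integrable by \<open>int_hyp\<close> or \<open>int_pow\<close>.\<close>
    also have "\<dots> = (LINT t|lborel. g (Complex c t) * hyp1F1 a b (2 * Complex c t / of_real \<beta>) * \<i>
        - (\<Sum>k<N. A k / of_real \<beta> ^ k * (g (Complex c t) * Complex c t ^ k * \<i>)))"
      unfolding vline_integral_def
      by (subst Bochner_Integration.integral_diff, (intro int_hyp \<beta> Bochner_Integration.integrable_sum integrable_mult_right int_pow)+,
          subst Bochner_Integration.integral_sum, (intro integrable_mult_right int_pow)) simp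
    also have "\<dots> = (LINT t|lborel. g (Complex c t) * R N \<beta> (Complex c t) * \<i>)"
      by (intro Bochner_Integration.integral_cong)
         (auto simp: R_def right_diff_distrib left_diff_distrib sum_distrib_left sum_distrib_right mult_ac)
    also have "norm \<dots> \<le> (LINT t|lborel. M * 4 ^ N * fact N * C * exp (2 * \<bar>c\<bar>) / \<beta> ^ N * exp (- \<bar>t\<bar>))"
      using R_le[OF \<beta>]
      by (intro Bochner_Integration.integral_norm_bound_integral int_R[OF \<beta>]
            integrable_mult_right integrable_exp_minus_abs) (simp add: norm_mult)
    also have "\<dots> = B * norm (1 / of_real \<beta> ^ N :: real)"
      using \<beta> by (simp add: B_def)
    finally show ?thesis .
  qed
  then show "(\<lambda>\<beta>. vline_integral c (\<lambda>s. g s * hyp1F1 a b (2 * s / of_real \<beta>))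
      - (\<Sum>k<N. 2 ^ k * pochhammer a k / (fact k * pochhammer b k)
          * vline_integral c (\<lambda>s. g s * s ^ k) / of_real \<beta> ^ k)) \<in> O(\<lambda>\<beta>. 1 / of_real \<beta> ^ N)"
    unfolding A_def[symmetric]
    by (intro bigoI[of _ B] eventually_mono[OF eventually_ge_at_top[of 4]]) (auto simp: norm_divide norm_power)
qed

section \<open>Decay of the Fermi-Dirac weights\<close>

text \<open>The real part of the sine at \<open>c + i t\<close> is
  \<open>sin (pi * c) * cosh (pi * t)\<close>, and \<open>cosh x\<close> is at least
  \<open>exp \<bar>x\<bar> / 2\<close>; then \<open>pi > 3\<close>.\<close>

lemma norm_sin_vline_ge:
  assumes "0 < c" "c < 1"
  shows "norm (sin (of_real pi * Complex c t)) \<ge> sin (pi * c) * exp (3 * \<bar>t\<bar>) / 2"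
proof -
  have sin_pos: "sin (pi * c) > 0"
    using assms by (intro sin_gt_zero) auto
  have "exp (3 * \<bar>t\<bar>) \<le> exp (pi * \<bar>t\<bar>)"
    using pi_gt3 by (simp add: mult_right_mono)
  also have "\<dots> \<le> exp (pi * t) + exp (- (pi * t))"
    by (cases "t \<ge> 0") auto
  finally have "sin (pi * c) * exp (3 * \<bar>t\<bar>) / 2 \<le> Re (sin (of_real pi * Complex c t))"
    using sin_pos by (simp add: Re_sin)
  also have "\<dots> \<le> norm (sin (of_real pi * Complex c t))"
    by (rule complex_Re_le_cmod)
  finally show ?thesis .
qed

text \<open>Supplies the two hypotheses of \<open>vline_integral_hyp1F1_asymp\<close>. The factor
  \<open>h\<close> will be 1 or a principal power, the latter being continuous on the right
  half-plane.\<close>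

lemma FD_weight:
  fixes h :: "complex \<Rightarrow> complex" and \<eta> :: real
  assumes c: "0 < c" "c < 1"
    and h: "continuous_on {s. Re s > 0} h"
    and bound: "\<And>t. norm (h (Complex c t)) \<le> B"
  defines "g \<equiv> \<lambda>s. exp (of_real \<eta> * s) * h s / sin (of_real pi * s) / (2 * \<i>)"
  shows "(\<lambda>t. g (Complex c t)) \<in> borel_measurable borel"
    and "norm (g (Complex c t)) \<le> exp (\<eta> * c) * B / sin (pi * c) * exp (- 3 * \<bar>t\<bar>)"
proof -
  have sin_pos: "sin (pi * c) > 0"
    using c by (intro sin_gt_zero) auto
  have low: "0 < sin (pi * c) * exp (3 * \<bar>t\<bar>) / 2" for t
    using sin_pos by simp
  \<comment> \<open>The positive lower bound excludes zeros of the sine on the line, so the weight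
    is continuous in \<open>t\<close>.\<close>
  have "sin (of_real pi * Complex c t) \<noteq> 0" for t
    using low[of t] norm_sin_vline_ge[OF c, of t] by force
  moreover have "continuous_on UNIV (\<lambda>t. Complex c t)"
    by (auto simp: Complex_eq intro!: continuous_intros)
  moreover from this have "continuous_on UNIV (\<lambda>t. h (Complex c t))"
    using c by (intro continuous_on_compose2[OF h]) auto
  ultimately show "(\<lambda>t. g (Complex c t)) \<in> borel_measurable borel"
    unfolding g_def by (intro borel_measurable_continuous_onI continuous_intros) auto
  have B0: "B \<ge> 0"
    using order_trans[OF norm_ge_zero bound] .
  have "norm (g (Complex c t)) = exp (\<eta> * c) * norm (h (Complex c t)) / norm (sin (of_real pi * Complex c t)) / 2"
    by (simp add: g_def norm_mult norm_divide)
  also have "\<dots> \<le> exp (\<eta> * c) * B / (sin (pi * c) * exp (3 * \<bar>t\<bar>) / 2) / 2"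
    using low[of t] norm_sin_vline_ge[OF c, of t] bound[of t] B0
    by (intro divide_right_mono frac_le mult_left_mono) auto
  also have "\<dots> = exp (\<eta> * c) * B / sin (pi * c) * exp (- 3 * \<bar>t\<bar>)"
    using sin_pos by (simp add: exp_minus field_simps)
  finally show "norm (g (Complex c t)) \<le> exp (\<eta> * c) * B / sin (pi * c) * exp (- 3 * \<bar>t\<bar>)" .
qed

section \<open>The two expansions\<close>

theorem lemma5p2:
  fixes \<eta> q c :: real
  assumes "q \<ge> 0" and "\<And>n::nat. q \<noteq> real n + 1/2"
    and "0 < c" and "c < 1"
  shows "has_asymp_series (\<lambda>\<beta>. FD1 c q \<eta> \<beta>) (\<lambda>k. of_real (c_coeff q k) * Phi1 c k \<eta>) \<and>
         has_asymp_series (\<lambda>\<beta>. FD2 c q \<eta> \<beta>) (\<lambda>k. of_real (d_coeff q k) * Phi2 c k \<eta> q)"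
proof
  note c = assms(3,4)
  have nz: "Complex c t \<noteq> 0" for t
    using c by (simp add: complex_eq_iff)
  \<comment> \<open>In both integrands the factor \<pi> cancels against the prefactor, leaving
    \<open>1 / (2 * \<i>)\<close>. The remaining powers of \<open>s\<close> form \<open>h\<close>:
    \<open>s / s = 1\<close> for \<open>FD1\<close>, and \<open>s / s powr (q + 5/2)\<close>, which
    is \<open>p\<close>, for \<open>FD2\<close>.\<close>
  define w where "w h s = exp (of_real \<eta> * s) * h s / sin (of_real pi * s) / (2 * \<i>)"
    for h :: "complex \<Rightarrow> complex" and s
  define p where "p s = s powr of_real (- q - 3/2)" for s :: complex
  have pc: "of_real (pochhammer x k) = (pochhammer (of_real x) k :: complex)" for x k
    by (simp add: pochhammer_of_real)
  have w1: "has_asymp_series (\<lambda>\<beta>. vline_integral c (\<lambda>s. w (\<lambda>_. 1) s * hyp1F1 a b (2 * s / of_real \<beta>)))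
     (\<lambda>k. 2 ^ k * pochhammer a k / (fact k * pochhammer b k) * vline_integral c (\<lambda>s. w (\<lambda>_. 1) s * s ^ k))" for a b
    unfolding w_def
    by (rule vline_integral_hyp1F1_asymp; rule FD_weight[OF c, where B = 1]) (auto intro: continuous_intros)
  have p_cont: "continuous_on {s. Re s > 0} p"
    unfolding p_def by (intro continuous_intros) (auto simp: complex_nonpos_Reals_iff)
  \<comment> \<open>The exponent is negative and \<open>norm s \<ge> Re s = c\<close>, so the norm
    is largest at \<open>t = 0\<close>.\<close>
  have p_bound: "norm (p (Complex c t)) \<le> c powr (- q - 3/2)" for t
  proof -
    have "norm (p (Complex c t)) = norm (Complex c t) powr (- q - 3/2)"
      unfolding p_def by (subst norm_powr_real_powr') (auto simp: nz)
    also have "\<dots> \<le> c powr (- q - 3/2)"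
      using assms(1) c complex_Re_le_cmod[of "Complex c t"] by (intro powr_mono2') auto
    finally show ?thesis .
  qed
  have w2: "has_asymp_series (\<lambda>\<beta>. vline_integral c (\<lambda>s. w p s * hyp1F1 a b (2 * s / of_real \<beta>)))
     (\<lambda>k. 2 ^ k * pochhammer a k / (fact k * pochhammer b k) * vline_integral c (\<lambda>s. w p s * s ^ k))" for a b
    unfolding w_def
    by (rule vline_integral_hyp1F1_asymp; rule FD_weight[OF c p_cont p_bound])
  have "FD1 c q \<eta> \<beta> = vline_integral c
      (\<lambda>s. w (\<lambda>_. 1) s * hyp1F1 (of_real (q + 1)) (of_real (q + 5/2)) (2 * s / of_real \<beta>))" for \<beta>
    unfolding FD1_def vline_integral_mult[symmetric]
    by (rule vline_integral_cong) (simp add: w_def nz mult_ac)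
  moreover have "Phi1 c k \<eta> = vline_integral c (\<lambda>s. w (\<lambda>_. 1) s * s ^ k)" for k
    unfolding Phi1_def vline_integral_mult[symmetric]
    by (rule vline_integral_cong) (simp add: w_def mult_ac)
  moreover have "of_real (c_coeff q k) = 2 ^ k * pochhammer (of_real (q + 1)) k
      / (fact k * pochhammer (of_real (q + 5/2)) k :: complex)" for k
    unfolding c_coeff_def pc[symmetric] by simp
  ultimately show "has_asymp_series (\<lambda>\<beta>. FD1 c q \<eta> \<beta>) (\<lambda>k. of_real (c_coeff q k) * Phi1 c k \<eta>)"
    using w1 by simp

  have "FD2 c q \<eta> \<beta> = vline_integral c
      (\<lambda>s. w p s * hyp1F1 (of_real (- 1/2)) (of_real (- q - 1/2)) (2 * s / of_real \<beta>))" for \<beta>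
    unfolding FD2_def vline_integral_mult[symmetric]
  proof (rule vline_integral_cong)
    fix t
    define s where "s = Complex c t"
    \<comment> \<open>Writing the exponent as \<open>1 - (q + 5/2)\<close> splits off the
      \<open>s\<close> of the numerator; the power laws used here and for \<open>Phi2\<close> rely
      on \<open>s\<close> being nonzero.\<close>
    have "p s = s powr (1 - of_real (q + 5/2))"
      unfolding p_def by (intro arg_cong[of _ _ "(powr) s"]) simp
    also have "\<dots> = s / s powr of_real (q + 5/2)"
      using nz[of t] by (subst powr_diff) (simp_all add: s_def)
    finally show "1 / (2 * of_real pi * \<i>) * (exp (of_real \<eta> * Complex c t)
        * (of_real pi * Complex c t / sin (of_real pi * Complex c t))
        * hyp1F1 (of_real (- 1/2)) (of_real (- q - 1/2)) (2 * Complex c t / of_real \<beta>)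
        / Complex c t powr of_real (q + 5/2))
      = w p (Complex c t) * hyp1F1 (of_real (- 1/2)) (of_real (- q - 1/2)) (2 * Complex c t / of_real \<beta>)"
      unfolding w_def s_def[symmetric] by (simp add: mult_ac)
  qed
  moreover have "Phi2 c k \<eta> q = vline_integral c (\<lambda>s. w p s * s ^ k)" for k
    unfolding Phi2_def vline_integral_mult[symmetric]
  proof (rule vline_integral_cong)
    fix t
    define s where "s = Complex c t"
    \<comment> \<open>An integer shift of the exponent of a principal power is multiplication by an
      ordinary power, with no branch correction.\<close>
    have "s powr of_real (real k - q - 3/2) = s powr (of_real (- q - 3/2) + of_nat k)"
      by (intro arg_cong[of _ _ "(powr) s"]) simp
    also have "\<dots> = p s * s ^ k"
      using nz[of t] by (subst powr_add) (simp_all add: p_def s_def powr_nat')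
    finally show "1 / (2 * \<i>) * (exp (of_real \<eta> * Complex c t) * Complex c t powr of_real (real k - q - 3/2)
        / sin (of_real pi * Complex c t)) = w p (Complex c t) * Complex c t ^ k"
      unfolding w_def s_def[symmetric] by (simp add: mult_ac)
  qed
  moreover have "of_real (d_coeff q k) = 2 ^ k * pochhammer (of_real (- 1/2)) k
      / (fact k * pochhammer (of_real (- q - 1/2)) k :: complex)" for k
    unfolding d_coeff_def pc[symmetric] by simp
  ultimately show "has_asymp_series (\<lambda>\<beta>. FD2 c q \<eta> \<beta>) (\<lambda>k. of_real (d_coeff q k) * Phi2 c k \<eta> q)"
    using w2 by simp
qed

end
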